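(* Let $\mathcal{D}=\langle D,\Pi\rangle$ be a constraint system and $\phi$ a CLTLB($\mathcal{D}$) formula. If there exist $k>0$, a finite path $\pi=s_0s_1\dots s_k$ and a local sequence $\widehat{\sigma}_k$ such that $\pi^0_{\widehat{\sigma}_k}\models_k\phi$ (bounded semantics), then $\phi$ is satisfiable over $k$-partial $\mathcal{D}$-valuations.
   Context: Let $V$ be a set of variables and $AP$ a set of atomic propositions. Arithmetic temporal terms (a.t.t.'s): $\varphi::=x\mid\mathbf{X}\varphi\mid\mathbf{Y}\varphi$, $x\in V$, each containing one variable $x_\varphi$, depth $|x|=0$, $|\mathbf{X}\varphi|=|\varphi|+1$, $|\mathbf{Y}\varphi|=|\varphi|-1$. CLTLB($\mathcal{D}$) formulae (in positive normal form): $\phi::=p\mid\neg p\mid R(\varphi_1,\dots,\varphi_n)\mid\neg R(\varphi_1,\dots,\varphi_n)\mid\phi\wedge\phi\mid\phi\vee\phi\mid\mathbf{X}\phi\mid\mathbf{Y}\phi\mid\mathbf{Z}\phi\mid\phi\mathbf{U}\phi\mid\phi\mathbf{R}\phi\mid\phi\mathbf{S}\phi\mid\phi\mathbf{T}\phi$, where $\phi\mathbf{R}\psi\equiv\neg(\neg\phi\mathbf{U}\neg\psi)$, $\phi\mathbf{T}\psi\equiv\neg(\neg\phi\mathbf{S}\neg\psi)$, $\mathbf{Z}\phi\equiv\neg\mathbf{Y}\neg\phi$. Let $\lceil\phi\rceil_x=\max(\{0\}\cup\{|\varphi|\})$, $\lfloor\phi\rfloor_x=\min(\{0\}\cup\{|\varphi|\})$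 over a.t.t.'s $\varphi$ of $\phi$ containing $x$; $\lfloor\phi\rfloor=\min_x\lfloor\phi\rfloor_x$. $k$-partial valuations: a $k$-partial $\mathcal{D}$-valuation is a relation $\sigma_k\subseteq\{i\in\mathbb{Z}:i\ge\lfloor\phi\rfloor\}\times V\times D$ whose restriction, for each variable $x$ of $\phi$, to $\{i:\lfloor\phi\rfloor_x\le i\le k+\lceil\phi\rceil_x\}\times\{x\}\times D$ is a function of $(i,x)$. For an infinite path $\pi=s_0s_1\dots$ over a state set $S$ and $L:S\to2^{AP}$: $\pi^i_{\sigma_k}\models p$ iff $p\in L(s_i)$; $\pi^i_{\sigma_k}\models R(\varphi_1,\dots,\varphi_n)$ iff for all $y_1,\dots,y_n$ with $(i+|\varphi_j|,x_{\varphi_j},y_j)\in\sigma_k$ for all $j$, $(y_1,\dots,y_n)\in R$; negation, $\wedge,\vee$ as usual; $\mathbf{X}\phi$ at $i$ iff $\phi$ at $i+1$; $\mathbf{Y}\phi$ at $i$ iff $i>0$ and $\phi$ at $i-1$; $\phi\mathbf{U}\psi$ at $i$ iff some $j\ge i$ satisfies $\psi$ and all $i\le n<j$ satisfy $\phi$; $\phi\mathbf{S}\psi$ at $i$ iff some $0\le j\le i$ satisfies $\psi$ and all $j<n\le i$ satisfy $\phi$; duals accordingly. $\phi$ is satisfiable over $k$-partial $\mathcal{D}$-valuations if some $(S,s_0,\pi,\sigma_k,L)$ with $\pi\in s_0S^\omega$ gives $\pi^0_{\sigma_k}\models\phi$. Bounded semantics: a local sequence is $\widehat{\sigma}_k$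 assigning to each variable $x$ a function $\{i\in\mathbb{Z}:\lfloor\phi\rfloor_x\le i\le k+\lceil\phi\rceil_x\}\to D$. A finite path $\pi\in S^+$ is cyclic if it has the form $usvs$ with $s\in S$, $u,v\in S^*$. If $\pi=usvs$ is cyclic, $\pi^i_{\widehat{\sigma}_k}\models_k\phi$ is defined as $\pi'^i_{\widehat{\sigma}_k}\models\phi$ for the infinite path $\pi'=u(sv)^\omega$, with $\widehat{\sigma}_k$ viewed as a relation and relations interpreted as in the $k$-partial semantics above. If $\pi$ is not cyclic, then for $0\le i\le k$: $\pi^i\models_k p$ iff $p\in L(s_i)$; $\pi^i\models_k R(\varphi_1,\dots,\varphi_n)$ iff $(\widehat{\sigma}_k(i+|\varphi_1|,x_{\varphi_1}),\dots,\widehat{\sigma}_k(i+|\varphi_n|,x_{\varphi_n}))\in R$; Boolean connectives as usual; $\pi^i\models_k\mathbf{X}\phi$ iff $i+1\le k$ and $\pi^{i+1}\models_k\phi$; $\pi^i\models_k\phi\mathbf{U}\psi$ iff there is $i\le j\le k$ with $\pi^j\models_k\psi$ and $\pi^n\models_k\phi$ for all $i\le n<j$; $\pi^i\models_k\phi\mathbf{R}\psi$ iff there is $i\le j\le k$ with $\pi^j\models_k\phi$ and $\pi^n\models_k\psi$ for all $i\le n\le j$; past operators are evaluated as in the infinite semantics (they only refer to instants in $[0,i]$). *)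

theory Defs
  imports "HOL-Library.Omega_Words_Fun"
begin

text \<open>
  A constraint system \<open>\<langle>D, \<Pi>\<rangle>\<close>: the family \<open>\<Pi>\<close> of relations over \<open>D\<close> is indexed by the
  symbols in \<open>rels\<close>; a relation is the set of its tuples, represented as lists.
\<close>

record ('d, 'r) csystem =
  domain :: "'d set"
  rels :: "'r set"
  arity :: "'r \<Rightarrow> nat"
  interp :: "'r \<Rightarrow> 'd list set"

definition constraint_system :: "('d, 'r) csystem \<Rightarrow> bool" where
  "constraint_system \<D> \<longleftrightarrow>
     (\<forall>r \<in> rels \<D>. interp \<D> r \<subseteq> {ys. length ys = arity \<D> r \<and> set ys \<subseteq> domain \<D>})"

datatype 'v att = Var 'v | XT "'v att" | YT "'v att"

primrec att_var :: "'v att \<Rightarrow> 'v" where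
  "att_var (Var x) = x"
| "att_var (XT t) = att_var t"
| "att_var (YT t) = att_var t"

primrec depth :: "'v att \<Rightarrow> int" where
  "depth (Var x) = 0"
| "depth (XT t) = depth t + 1"
| "depth (YT t) = depth t - 1"

datatype ('v, 'p, 'r) formula =
    Prop 'p
  | NProp 'p
  | Rel 'r "'v att list"
  | NRel 'r "'v att list"
  | And "('v, 'p, 'r) formula" "('v, 'p, 'r) formula"
  | Or "('v, 'p, 'r) formula" "('v, 'p, 'r) formula"
  | Next "('v, 'p, 'r) formula"
  | Yesterday "('v, 'p, 'r) formula"
  | WYesterday "('v, 'p, 'r) formula"
  | Until "('v, 'p, 'r) formula" "('v, 'p, 'r) formula"
  | Release "('v, 'p, 'r) formula" "('v, 'p, 'r) formula"
  | Since "('v, 'p, 'r) formula" "('v, 'p, 'r) formula"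
  | Trigger "('v, 'p, 'r) formula" "('v, 'p, 'r) formula"

primrec constraints :: "('v, 'p, 'r) formula \<Rightarrow> ('r \<times> 'v att list) set" where
  "constraints (Prop p) = {}"
| "constraints (NProp p) = {}"
| "constraints (Rel r ts) = {(r, ts)}"
| "constraints (NRel r ts) = {(r, ts)}"
| "constraints (And \<phi> \<psi>) = constraints \<phi> \<union> constraints \<psi>"
| "constraints (Or \<phi> \<psi>) = constraints \<phi> \<union> constraints \<psi>"
| "constraints (Next \<phi>) = constraints \<phi>"
| "constraints (Yesterday \<phi>) = constraints \<phi>"
| "constraints (WYesterday \<phi>) = constraints \<phi>"
| "constraints (Until \<phi> \<psi>) = constraints \<phi> \<union> constraints \<psi>"
| "constraints (Release \<phi> \<psi>) = constraints \<phi> \<union> constraints \<psi>"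
| "constraints (Since \<phi> \<psi>) = constraints \<phi> \<union> constraints \<psi>"
| "constraints (Trigger \<phi> \<psi>) = constraints \<phi> \<union> constraints \<psi>"

definition cltlb_formula :: "('d, 'r) csystem \<Rightarrow> ('v, 'p, 'r) formula \<Rightarrow> bool" where
  "cltlb_formula \<D> \<phi> \<longleftrightarrow>
     (\<forall>(r, ts) \<in> constraints \<phi>. r \<in> rels \<D> \<and> length ts = arity \<D> r)"

text \<open>The a.t.t.'s of a formula are the arguments of its atomic constraints, not their
  proper subterms.\<close>

definition atts :: "('v, 'p, 'r) formula \<Rightarrow> 'v att set" where
  "atts \<phi> = (\<Union>(r, ts) \<in> constraints \<phi>. set ts)"

definition max_depth :: "('v, 'p, 'r) formula \<Rightarrow> 'v \<Rightarrow> int" where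
  "max_depth \<phi> x = Max ({0} \<union> depth ` {t \<in> atts \<phi>. att_var t = x})"

definition min_depth :: "('v, 'p, 'r) formula \<Rightarrow> 'v \<Rightarrow> int" where
  "min_depth \<phi> x = Min ({0} \<union> depth ` {t \<in> atts \<phi>. att_var t = x})"

text \<open>
  The set below is finite, as \<open>min_depth \<phi> x\<close> is \<open>0\<close> for all variables \<open>x\<close> outside \<open>\<phi>\<close>.
\<close>

definition min_depth_all :: "('v, 'p, 'r) formula \<Rightarrow> int" where
  "min_depth_all \<phi> = Min (range (min_depth \<phi>))"

definition partial_valuation ::
  "('d, 'r) csystem \<Rightarrow> nat \<Rightarrow> ('v, 'p, 'r) formula \<Rightarrow> (int \<times> 'v \<times> 'd) set \<Rightarrow> bool" where
  "partial_valuation \<D> k \<phi> \<sigma> \<longleftrightarrow>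
     \<sigma> \<subseteq> {min_depth_all \<phi>..} \<times> UNIV \<times> domain \<D> \<and>
     (\<forall>x \<in> att_var ` atts \<phi>. \<forall>i \<in> {min_depth \<phi> x..int k + max_depth \<phi> x}. \<exists>!d. (i, x, d) \<in> \<sigma>)"

definition rel_holds ::
  "('d, 'r) csystem \<Rightarrow> (int \<times> 'v \<times> 'd) set \<Rightarrow> nat \<Rightarrow> 'r \<Rightarrow> 'v att list \<Rightarrow> bool" where
  "rel_holds \<D> \<sigma> i r ts \<longleftrightarrow>
     (\<forall>ys. list_all2 (\<lambda>t y. (int i + depth t, att_var t, y) \<in> \<sigma>) ts ys \<longrightarrow> ys \<in> interp \<D> r)"

primrec sat ::
  "('d, 'r) csystem \<Rightarrow> ('s \<Rightarrow> 'p set) \<Rightarrow> 's word \<Rightarrow> (int \<times> 'v \<times> 'd) set \<Rightarrow> nat \<Rightarrow>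
   ('v, 'p, 'r) formula \<Rightarrow> bool" where
  "sat \<D> L \<pi> \<sigma> i (Prop p) \<longleftrightarrow> p \<in> L (\<pi> i)"
| "sat \<D> L \<pi> \<sigma> i (NProp p) \<longleftrightarrow> p \<notin> L (\<pi> i)"
| "sat \<D> L \<pi> \<sigma> i (Rel r ts) \<longleftrightarrow> rel_holds \<D> \<sigma> i r ts"
| "sat \<D> L \<pi> \<sigma> i (NRel r ts) \<longleftrightarrow> \<not> rel_holds \<D> \<sigma> i r ts"
| "sat \<D> L \<pi> \<sigma> i (And \<phi> \<psi>) \<longleftrightarrow> sat \<D> L \<pi> \<sigma> i \<phi> \<and> sat \<D> L \<pi> \<sigma> i \<psi>"
| "sat \<D> L \<pi> \<sigma> i (Or \<phi> \<psi>) \<longleftrightarrow> sat \<D> L \<pi> \<sigma> i \<phi> \<or> sat \<D> L \<pi> \<sigma> i \<psi>"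
| "sat \<D> L \<pi> \<sigma> i (Next \<phi>) \<longleftrightarrow> sat \<D> L \<pi> \<sigma> (i + 1) \<phi>"
| "sat \<D> L \<pi> \<sigma> i (Yesterday \<phi>) \<longleftrightarrow> i > 0 \<and> sat \<D> L \<pi> \<sigma> (i - 1) \<phi>"
| "sat \<D> L \<pi> \<sigma> i (WYesterday \<phi>) \<longleftrightarrow> \<not> (i > 0 \<and> \<not> sat \<D> L \<pi> \<sigma> (i - 1) \<phi>)"
| "sat \<D> L \<pi> \<sigma> i (Until \<phi> \<psi>) \<longleftrightarrow>
     (\<exists>j\<ge>i. sat \<D> L \<pi> \<sigma> j \<psi> \<and> (\<forall>n. i \<le> n \<and> n < j \<longrightarrow> sat \<D> L \<pi> \<sigma> n \<phi>))"
| "sat \<D> L \<pi> \<sigma> i (Release \<phi> \<psi>) \<longleftrightarrow>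
     \<not> (\<exists>j\<ge>i. \<not> sat \<D> L \<pi> \<sigma> j \<psi> \<and> (\<forall>n. i \<le> n \<and> n < j \<longrightarrow> \<not> sat \<D> L \<pi> \<sigma> n \<phi>))"
| "sat \<D> L \<pi> \<sigma> i (Since \<phi> \<psi>) \<longleftrightarrow>
     (\<exists>j\<le>i. sat \<D> L \<pi> \<sigma> j \<psi> \<and> (\<forall>n. j < n \<and> n \<le> i \<longrightarrow> sat \<D> L \<pi> \<sigma> n \<phi>))"
| "sat \<D> L \<pi> \<sigma> i (Trigger \<phi> \<psi>) \<longleftrightarrow>
     \<not> (\<exists>j\<le>i. \<not> sat \<D> L \<pi> \<sigma> j \<psi> \<and> (\<forall>n. j < n \<and> n \<le> i \<longrightarrow> \<not> sat \<D> L \<pi> \<sigma> n \<phi>))"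

text \<open>
  HOL cannot quantify over the type of states, so it is an explicit type argument;
  the set of states \<open>S\<close> ranges over all subsets of that type.
\<close>

definition partially_satisfiable ::
  "'s itself \<Rightarrow> ('d, 'r) csystem \<Rightarrow> nat \<Rightarrow> ('v, 'p, 'r) formula \<Rightarrow> bool" where
  "partially_satisfiable _ \<D> k \<phi> \<longleftrightarrow>
     (\<exists>(S :: 's set) s\<^sub>0 (\<pi> :: 's word) \<sigma> L.
        s\<^sub>0 \<in> S \<and> \<pi> 0 = s\<^sub>0 \<and> range \<pi> \<subseteq> S \<and> partial_valuation \<D> k \<phi> \<sigma> \<and> sat \<D> L \<pi> \<sigma> 0 \<phi>)"

definition local_sequence ::
  "('d, 'r) csystem \<Rightarrow> nat \<Rightarrow> ('v, 'p, 'r) formula \<Rightarrow> ('v \<Rightarrow> int \<rightharpoonup> 'd) \<Rightarrow> bool" where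
  "local_sequence \<D> k \<phi> \<sigma> \<longleftrightarrow>
     (\<forall>x. dom (\<sigma> x) = {min_depth \<phi> x..int k + max_depth \<phi> x} \<and> ran (\<sigma> x) \<subseteq> domain \<D>)"

definition local_graph :: "('v \<Rightarrow> int \<rightharpoonup> 'd) \<Rightarrow> (int \<times> 'v \<times> 'd) set" where
  "local_graph \<sigma> = {(i, x, d). \<sigma> x i = Some d}"

definition cyclic :: "'s list \<Rightarrow> bool" where
  "cyclic \<pi> \<longleftrightarrow> (\<exists>u s v. \<pi> = u @ [s] @ v @ [s])"

definition rel_holds_local ::
  "('d, 'r) csystem \<Rightarrow> ('v \<Rightarrow> int \<rightharpoonup> 'd) \<Rightarrow> nat \<Rightarrow> 'r \<Rightarrow> 'v att list \<Rightarrow> bool" where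
  "rel_holds_local \<D> \<sigma> i r ts \<longleftrightarrow>
     map (\<lambda>t. the (\<sigma> (att_var t) (int i + depth t))) ts \<in> interp \<D> r"

primrec bsat_acyclic ::
  "('d, 'r) csystem \<Rightarrow> ('s \<Rightarrow> 'p set) \<Rightarrow> nat \<Rightarrow> 's list \<Rightarrow> ('v \<Rightarrow> int \<rightharpoonup> 'd) \<Rightarrow> nat \<Rightarrow>
   ('v, 'p, 'r) formula \<Rightarrow> bool" where
  "bsat_acyclic \<D> L k \<pi> \<sigma> i (Prop p) \<longleftrightarrow> p \<in> L (\<pi> ! i)"
| "bsat_acyclic \<D> L k \<pi> \<sigma> i (NProp p) \<longleftrightarrow> p \<notin> L (\<pi> ! i)"
| "bsat_acyclic \<D> L k \<pi> \<sigma> i (Rel r ts) \<longleftrightarrow> rel_holds_local \<D> \<sigma> i r ts"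
| "bsat_acyclic \<D> L k \<pi> \<sigma> i (NRel r ts) \<longleftrightarrow> \<not> rel_holds_local \<D> \<sigma> i r ts"
| "bsat_acyclic \<D> L k \<pi> \<sigma> i (And \<phi> \<psi>) \<longleftrightarrow>
     bsat_acyclic \<D> L k \<pi> \<sigma> i \<phi> \<and> bsat_acyclic \<D> L k \<pi> \<sigma> i \<psi>"
| "bsat_acyclic \<D> L k \<pi> \<sigma> i (Or \<phi> \<psi>) \<longleftrightarrow>
     bsat_acyclic \<D> L k \<pi> \<sigma> i \<phi> \<or> bsat_acyclic \<D> L k \<pi> \<sigma> i \<psi>"
| "bsat_acyclic \<D> L k \<pi> \<sigma> i (Next \<phi>) \<longleftrightarrow> i + 1 \<le> k \<and> bsat_acyclic \<D> L k \<pi> \<sigma> (i + 1) \<phi>"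
| "bsat_acyclic \<D> L k \<pi> \<sigma> i (Yesterday \<phi>) \<longleftrightarrow> i > 0 \<and> bsat_acyclic \<D> L k \<pi> \<sigma> (i - 1) \<phi>"
| "bsat_acyclic \<D> L k \<pi> \<sigma> i (WYesterday \<phi>) \<longleftrightarrow>
     \<not> (i > 0 \<and> \<not> bsat_acyclic \<D> L k \<pi> \<sigma> (i - 1) \<phi>)"
| "bsat_acyclic \<D> L k \<pi> \<sigma> i (Until \<phi> \<psi>) \<longleftrightarrow>
     (\<exists>j. i \<le> j \<and> j \<le> k \<and> bsat_acyclic \<D> L k \<pi> \<sigma> j \<psi> \<and>
       (\<forall>n. i \<le> n \<and> n < j \<longrightarrow> bsat_acyclic \<D> L k \<pi> \<sigma> n \<phi>))"
| "bsat_acyclic \<D> L k \<pi> \<sigma> i (Release \<phi> \<psi>) \<longleftrightarrow>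
     (\<exists>j. i \<le> j \<and> j \<le> k \<and> bsat_acyclic \<D> L k \<pi> \<sigma> j \<phi> \<and>
       (\<forall>n. i \<le> n \<and> n \<le> j \<longrightarrow> bsat_acyclic \<D> L k \<pi> \<sigma> n \<psi>))"
| "bsat_acyclic \<D> L k \<pi> \<sigma> i (Since \<phi> \<psi>) \<longleftrightarrow>
     (\<exists>j\<le>i. bsat_acyclic \<D> L k \<pi> \<sigma> j \<psi> \<and>
       (\<forall>n. j < n \<and> n \<le> i \<longrightarrow> bsat_acyclic \<D> L k \<pi> \<sigma> n \<phi>))"
| "bsat_acyclic \<D> L k \<pi> \<sigma> i (Trigger \<phi> \<psi>) \<longleftrightarrow>
     \<not> (\<exists>j\<le>i. \<not> bsat_acyclic \<D> L k \<pi> \<sigma> j \<psi> \<and>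
         (\<forall>n. j < n \<and> n \<le> i \<longrightarrow> \<not> bsat_acyclic \<D> L k \<pi> \<sigma> n \<phi>))"

text \<open>
  A cyclic path may have several decompositions \<open>usvs\<close>; it is satisfying if one of
  the induced infinite paths is.
\<close>

definition bsat ::
  "('d, 'r) csystem \<Rightarrow> ('s \<Rightarrow> 'p set) \<Rightarrow> nat \<Rightarrow> 's list \<Rightarrow> ('v \<Rightarrow> int \<rightharpoonup> 'd) \<Rightarrow> nat \<Rightarrow>
   ('v, 'p, 'r) formula \<Rightarrow> bool" where
  "bsat \<D> L k \<pi> \<sigma> i \<phi> \<longleftrightarrow>
     (if cyclic \<pi>
      then \<exists>u s v. \<pi> = u @ [s] @ v @ [s] \<and>
             sat \<D> L (u \<frown> ([s] @ v)\<^sup>\<omega>) (local_graph \<sigma>) i \<phi>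
      else bsat_acyclic \<D> L k \<pi> \<sigma> i \<phi>)"

end

theory Submission
  imports Defs
begin

text \<open>
  A cyclic path induces an infinite path that satisfies the formula by definition. For an
  acyclic path, a formula in positive normal form that holds in the bounded semantics is
  already witnessed by the instants up to \<open>k\<close>: bounded Until and Release both demand an
  explicit witness \<open>j \<le> k\<close>, and negation is applied to atoms only, on which the two semantics
  agree. Hence the formula holds on every infinite extension of the path.
\<close>

lemma finite_atts: "finite (atts \<phi>)"
proof -
  have "finite (constraints \<phi>)"
    by (induction \<phi>) auto
  then show ?thesis
    by (auto simp: atts_def)
qed

lemma min_depth_le:
  assumes "t \<in> atts \<phi>"
  shows "min_depth \<phi> (att_var t) \<le> depth t"
  unfolding min_depth_def using assms by (intro Min_le) (auto simp: finite_atts)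

lemma max_depth_ge:
  assumes "t \<in> atts \<phi>"
  shows "depth t \<le> max_depth \<phi> (att_var t)"
  unfolding max_depth_def using assms by (intro Max_ge) (auto simp: finite_atts)

lemma min_depth_in: "min_depth \<phi> x \<in> {0} \<union> depth ` atts \<phi>"
proof -
  have "min_depth \<phi> x \<in> {0} \<union> depth ` {t \<in> atts \<phi>. att_var t = x}"
    unfolding min_depth_def by (rule Min_in) (auto simp: finite_atts)
  then show ?thesis
    by auto
qed

text \<open>\<open>Min\<close> bounds only finite sets, and there may be infinitely many variables;
  but every value of \<open>min_depth\<close> is 0 or the depth of one of the finitely many
  a.t.t.'s.\<close>

lemma min_depth_all_le: "min_depth_all \<phi> \<le> min_depth \<phi> x"
proof -
  have "range (min_depth \<phi>) \<subseteq> {0} \<union> depth ` atts \<phi>"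
    by (rule image_subsetI) (rule min_depth_in)
  then have "finite (range (min_depth \<phi>))"
    by (rule finite_subset) (simp add: finite_atts)
  then show ?thesis
    unfolding min_depth_all_def by (intro Min_le) auto
qed

text \<open>Shifting an instant between 0 and \<open>k\<close> by a depth stays in the window: the
  lower end uses \<open>i\<close> \<ge> 0, the upper end \<open>i\<close> \<le>
  \<open>k\<close>.\<close>

lemma local_sequence_defined:
  assumes "local_sequence \<D> k \<phi> \<sigma>" "t \<in> atts \<phi>" "i \<le> k"
  shows "\<sigma> (att_var t) (int i + depth t) \<noteq> None"
proof -
  have "int i + depth t \<in> dom (\<sigma> (att_var t))"
    using assms min_depth_le[OF assms(2)] max_depth_ge[OF assms(2)]
    by (auto simp: local_sequence_def)
  then show ?thesis
    by auto
qed

lemma partial_valuation_local_graph: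
  assumes "local_sequence \<D> k \<phi> \<sigma>"
  shows "partial_valuation \<D> k \<phi> (local_graph \<sigma>)"
proof -
  have dom: "dom (\<sigma> x) = {min_depth \<phi> x..int k + max_depth \<phi> x}"
    and ran: "ran (\<sigma> x) \<subseteq> domain \<D>" for x
    using assms by (auto simp: local_sequence_def)
  have "min_depth_all \<phi> \<le> i \<and> d \<in> domain \<D>" if "\<sigma> x i = Some d" for x i d
  proof -
    have "i \<in> {min_depth \<phi> x..int k + max_depth \<phi> x}"
      using that dom[of x] by blast
    then show ?thesis
      using that ran[of x] min_depth_all_le[of \<phi> x] by (auto intro: ranI)
  qed
  moreover have "\<exists>!d. \<sigma> x i = Some d"
    if "i \<in> {min_depth \<phi> x..int k + max_depth \<phi> x}" for x i
    using that dom[of x] by auto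
  ultimately show ?thesis
    by (auto simp: partial_valuation_def local_graph_def)
qed

text \<open>Definedness leaves exactly one tuple in the universal quantifier of
  \<open>rel_holds\<close>, so it is never vacuously true. Being an equivalence, this also settles
  negated constraints.\<close>

lemma rel_holds_local_graph:
  assumes "\<forall>t \<in> set ts. \<sigma> (att_var t) (int i + depth t) \<noteq> None"
  shows "rel_holds \<D> (local_graph \<sigma>) i r ts \<longleftrightarrow> rel_holds_local \<D> \<sigma> i r ts"
proof -
  have "list_all2 (\<lambda>t y. (int i + depth t, att_var t, y) \<in> local_graph \<sigma>) ts ys \<longleftrightarrow>
      ys = map (\<lambda>t. the (\<sigma> (att_var t) (int i + depth t))) ts" for ys
    using assms
    by (induction ts arbitrary: ys) (auto simp: list_all2_Cons1 local_graph_def)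
  then show ?thesis
    by (simp add: rel_holds_def rel_holds_local_def)
qed

lemma atts_simps [simp]:
  "atts (Rel r ts) = set ts"
  "atts (NRel r ts) = set ts"
  "atts (And \<phi> \<psi>) = atts \<phi> \<union> atts \<psi>"
  "atts (Or \<phi> \<psi>) = atts \<phi> \<union> atts \<psi>"
  "atts (Next \<phi>) = atts \<phi>"
  "atts (Yesterday \<phi>) = atts \<phi>"
  "atts (WYesterday \<phi>) = atts \<phi>"
  "atts (Until \<phi> \<psi>) = atts \<phi> \<union> atts \<psi>"
  "atts (Release \<phi> \<psi>) = atts \<phi> \<union> atts \<psi>"
  "atts (Since \<phi> \<psi>) = atts \<phi> \<union> atts \<psi>"
  "atts (Trigger \<phi> \<psi>) = atts \<phi> \<union> atts \<psi>"
  by (simp_all add: atts_def)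

text \<open>Definedness is assumed per a.t.t. because it passes to subformulas, whereas
  \<open>local_sequence\<close> ties the domains exactly to one formula.\<close>

lemma bsat_acyclic_imp_sat:
  assumes "\<And>i. i \<le> k \<Longrightarrow> w i = \<pi> ! i"
    and "\<And>t i. t \<in> atts \<phi> \<Longrightarrow> i \<le> k \<Longrightarrow> \<sigma> (att_var t) (int i + depth t) \<noteq> None"
    and "i \<le> k"
    and "bsat_acyclic \<D> L k \<pi> \<sigma> i \<phi>"
  shows "sat \<D> L w (local_graph \<sigma>) i \<phi>"
  using assms(2-)
proof (induction \<phi> arbitrary: i)
  case (Rel r ts)
  then show ?case
    using rel_holds_local_graph[of ts \<sigma> i \<D> r] by simp
next
  case (NRel r ts)
  then show ?case
    using rel_holds_local_graph[of ts \<sigma> i \<D> r] by simp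
next
  case (Until \<phi> \<psi>)
  then obtain j where "i \<le> j" "j \<le> k" "bsat_acyclic \<D> L k \<pi> \<sigma> j \<psi>"
    and "\<forall>n. i \<le> n \<and> n < j \<longrightarrow> bsat_acyclic \<D> L k \<pi> \<sigma> n \<phi>"
    by auto
  then have "sat \<D> L w (local_graph \<sigma>) j \<psi>"
    and "\<forall>n. i \<le> n \<and> n < j \<longrightarrow> sat \<D> L w (local_graph \<sigma>) n \<phi>"
    using Until.IH Until.prems(1) by auto
  with \<open>i \<le> j\<close> show ?case
    by auto
next
  case (Release \<phi> \<psi>)
  then obtain j where "i \<le> j" "j \<le> k" "bsat_acyclic \<D> L k \<pi> \<sigma> j \<phi>"
    and "\<forall>n. i \<le> n \<and> n \<le> j \<longrightarrow> bsat_acyclic \<D> L k \<pi> \<sigma> n \<psi>"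
    by auto
  then have "sat \<D> L w (local_graph \<sigma>) j \<phi>"
    and "\<forall>n. i \<le> n \<and> n \<le> j \<longrightarrow> sat \<D> L w (local_graph \<sigma>) n \<psi>"
    using Release.IH Release.prems(1) by auto
  \<comment> \<open>A violation of \<open>\<psi>\<close> could only come after \<open>j\<close>, but
    by then \<open>\<phi>\<close> has already held at \<open>j\<close> and released it.\<close>
  with \<open>i \<le> j\<close> show ?case
    by (metis not_le sat.simps(11))
next
  case (Since \<phi> \<psi>)
  then obtain j where "j \<le> i" "bsat_acyclic \<D> L k \<pi> \<sigma> j \<psi>"
    and "\<forall>n. j < n \<and> n \<le> i \<longrightarrow> bsat_acyclic \<D> L k \<pi> \<sigma> n \<phi>"
    by auto
  then have "sat \<D> L w (local_graph \<sigma>) j \<psi>"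
    and "\<forall>n. j < n \<and> n \<le> i \<longrightarrow> sat \<D> L w (local_graph \<sigma>) n \<phi>"
    using Since.IH Since.prems(1,2) by auto
  with \<open>j \<le> i\<close> show ?case
    by auto
next
  case (Trigger \<phi> \<psi>)
  \<comment> \<open>Both operands of Trigger occur under two negations, so it is monotone in them: a
    violating instant for \<open>sat\<close> would also violate the bounded semantics.\<close>
  have "bsat_acyclic \<D> L k \<pi> \<sigma> n \<phi> \<longrightarrow> sat \<D> L w (local_graph \<sigma>) n \<phi>"
    and "bsat_acyclic \<D> L k \<pi> \<sigma> n \<psi> \<longrightarrow> sat \<D> L w (local_graph \<sigma>) n \<psi>" if "n \<le> i" for n
    using that Trigger.IH Trigger.prems(1,2) by auto
  with Trigger.prems(3) show ?case
    by simp blast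
\<comment> \<open>Literals see only states up to \<open>k\<close>, where \<open>w\<close> and
  \<open>\<pi>\<close> agree. The guard \<open>i + 1 \<le> k\<close> of bounded Next keeps the
  induction hypothesis applicable, and past steps only decrease \<open>i\<close>.\<close>
qed (auto simp: assms(1))

theorem theorem3:
  fixes \<D> :: "('d, 'r) csystem"
    and \<phi> :: "('v, 'p, 'r) formula"
    and k :: nat
    and S :: "'s set"
    and \<pi> :: "'s list"
    and \<sigma> :: "'v \<Rightarrow> int \<rightharpoonup> 'd"
    and L :: "'s \<Rightarrow> 'p set"
  assumes "constraint_system \<D>"
    and "cltlb_formula \<D> \<phi>"
    and "k > 0"
    and "length \<pi> = k + 1"
    and "set \<pi> \<subseteq> S"
    and "local_sequence \<D> k \<phi> \<sigma>"
    and "bsat \<D> L k \<pi> \<sigma> 0 \<phi>"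
  shows "partially_satisfiable TYPE('s) \<D> k \<phi>"
proof -
  have "\<exists>w. sat \<D> L w (local_graph \<sigma>) 0 \<phi>"
  proof (cases "cyclic \<pi>")
    case True
    then show ?thesis
      using assms(7) by (auto simp: bsat_def)
  next
    case False
    \<comment> \<open>The tail after instant \<open>k\<close> is arbitrary; repeating the last state
      is one choice. Length \<open>k + 1\<close> places all instants up to \<open>k\<close> inside
      the prefix.\<close>
    have "sat \<D> L (\<pi> \<frown> (\<lambda>_. last \<pi>)) (local_graph \<sigma>) 0 \<phi>"
    proof (rule bsat_acyclic_imp_sat)
      show "(\<pi> \<frown> (\<lambda>_. last \<pi>)) i = \<pi> ! i" if "i \<le> k" for i
        using that assms(4) by (simp add: conc_def)
      show "\<sigma> (att_var t) (int i + depth t) \<noteq> None" if "t \<in> atts \<phi>" "i \<le> k" for t i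
        using local_sequence_defined[OF assms(6) that] .
      show "bsat_acyclic \<D> L k \<pi> \<sigma> 0 \<phi>"
        using assms(7) False by (simp add: bsat_def)
    qed simp
    then show ?thesis
      by (intro exI)
  qed
  then obtain w where "sat \<D> L w (local_graph \<sigma>) 0 \<phi>" ..
  moreover note partial_valuation_local_graph[OF assms(6)]
  ultimately show ?thesis
    unfolding partially_satisfiable_def
    \<comment> \<open>With all of \<open>'s\<close> as state set, any \<open>w\<close> is a path
      over it starting in \<open>w 0\<close>.\<close>
    by (intro exI[of _ UNIV] exI[of _ "w 0"] exI[of _ w] exI[of _ "local_graph \<sigma>"] exI[of _ L]) simp
qed

end
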